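(* Let $\alpha=(a_1,\dots,a_n)\in\mathrm{UPF}_n$, and let $\pi_1|\pi_2|\cdots|\pi_m$ be its block structure. Then: (1) the number of rearrangements $\sigma$ of $\alpha$ such that $\sigma$ is again a unit interval parking function is $\binom{n}{|\pi_1|,\dots,|\pi_m|}$; (2) a rearrangement $\sigma$ of $\alpha$ lies in $\mathrm{UPF}_n$ if and only if, for each $j\in[m]$, the entries of $\sigma$ whose values belong to the block $\pi_j$ appear in $\sigma$ in the same relative order as in $\pi_j$ (i.e. in weakly increasing order).
   Context: Let $[n]=\{1,\dots,n\}$. A tuple $\alpha\in[n]^n$ is a parking function if for each $i\in[n]$ at least $i$ entries are at most $i$. Unit interval parking: $n$ cars enter in order $1,\dots,n$ a one-way street with spots $1,\dots,n$; with preference list $\alpha=(a_1,\dots,a_n)$, car $i$ parks in spot $a_i$ if free, otherwise in spot $a_i+1$ if it exists and is free, otherwise it fails. $\alpha$ is a unit interval parking function if all cars park; $\mathrm{UPF}_n$ denotes the set of these (they are parking functions). Block structure: for a parking function $\alpha$, let $\alpha^\uparrow=(a'_1,\dots,a'_n)$ be its weakly increasing rearrangement; cut $\alpha^\uparrow$ into consecutive segments $\pi_1|\pi_2|\cdots|\pi_m$ where a new segment begins at (and includes) each position $i$ with $a'_i=i$. Each $\pi_j$ is a block, $|\pi_j|$ its length. A rearrangement of $\alpha$ is any tuple obtained by permuting its entries. *)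

theory Defs
  imports "HOL-Library.Multiset"
begin

text \<open>
  The tuple \<open>(a\<^sub>1, \<dots>, a\<^sub>n)\<close> is the list \<open>[a\<^sub>1, \<dots>, a\<^sub>n]\<close>, so its entries are 1-based
  while list positions are 0-based.
\<close>

text \<open>\<open>S\<close> is the set of spots already occupied when the cars with the listed preferences arrive.\<close>

fun unit_interval_parks :: "nat \<Rightarrow> nat set \<Rightarrow> nat list \<Rightarrow> bool" where
  "unit_interval_parks n S [] \<longleftrightarrow> True"
| "unit_interval_parks n S (a # as) \<longleftrightarrow>
     (if a \<notin> S then unit_interval_parks n (insert a S) as
      else if a + 1 \<le> n \<and> a + 1 \<notin> S then unit_interval_parks n (insert (a + 1) S) as
      else False)"

definition UPF :: "nat \<Rightarrow> nat list set" where
  "UPF n = {\<alpha>. length \<alpha> = n \<and> set \<alpha> \<subseteq> {1..n} \<and> unit_interval_parks n {} \<alpha>}"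

text \<open>The 0-based positions \<open>i\<close> of the increasing rearrangement at which a block begins.\<close>

definition block_starts :: "nat list \<Rightarrow> nat list" where
  "block_starts \<alpha> = filter (\<lambda>i. sort \<alpha> ! i = i + 1) [0..<length \<alpha>]"

text \<open>
  Each block runs from its start \<open>s\<close> up to, but excluding, the next start \<open>t\<close>, or to the end.
  For a parking function position 0 is a start, so the blocks exhaust \<open>sort \<alpha>\<close>; for other
  lists the value carries no meaning.
\<close>

definition block_structure :: "nat list \<Rightarrow> nat list list" where
  "block_structure \<alpha> =
     map (\<lambda>(s, t). take (t - s) (drop s (sort \<alpha>)))
       (zip (block_starts \<alpha>) (tl (block_starts \<alpha>) @ [length \<alpha>]))"

definition multinomial :: "nat \<Rightarrow> nat list \<Rightarrow> nat" where
  "multinomial n ks = fact n div (\<Prod>k\<leftarrow>ks. fact k)"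

text \<open>The division is exact when the parts add up to \<open>n\<close>.\<close>

lemma prod_list_fact_dvd_fact_sum_list: "(\<Prod>k\<leftarrow>ks. fact k) dvd (fact (sum_list ks) :: nat)"
proof (induction ks)
  case (Cons k ks)
  have "(\<Prod>k\<leftarrow>k # ks. fact k) dvd (fact k * fact (sum_list ks) :: nat)"
    using Cons.IH by (simp add: mult_dvd_mono)
  also have "\<dots> dvd fact (sum_list (k # ks))"
    by (simp add: fact_fact_dvd_fact)
  finally show ?case .
qed simp

end

theory Submission
  imports Defs
begin

text \<open>
  Counting the cars with preference at most \<open>v\<close> against the free spots shows that the increasing
  rearrangement of a unit interval parking function has entry \<open>i\<close> or \<open>i + 1\<close> at the 0-based
  position \<open>i\<close>, the second value exactly at block starts. So a block occupying positions
  \<open>s, \<dots>, t - 1\<close> is \<open>s + 1, s + 1, s + 2, \<dots>, t - 1\<close>. If the cars of each block arrive in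
  increasing order, they fill the spots \<open>s + 1, \<dots>, t\<close> from left to right. Conversely, the first car
  violating the order parks in the spot equal to its preference, and then too few spots remain for
  the cars with smaller preferences. Hence the parking rearrangements are the shuffles of the blocks,
  which use pairwise disjoint sets of values.
\<close>

section \<open>Counting free spots\<close>

lemma card_Diff_insert:
  assumes "finite A"
  shows "card (A - S) = card (A - insert p S) + (if p \<in> A - S then 1 else 0)"
proof (cases "p \<in> A - S")
  case True
  then have "A - S = insert p (A - insert p S)" by auto
  then have "card (A - S) = card (insert p (A - insert p S))" by (rule arg_cong)
  also have "\<dots> = card (A - insert p S) + 1" using assms by simp
  finally show ?thesis using True by simp
next
  case False
  then have "A - insert p S = A - S" by auto
  then show ?thesis using False by (simp only: if_False add_0_right)
qed

text \<open>Cars with preference at most \<open>v\<close> occupy distinct free spots up to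
  \<open>v + 1\<close>; since no preference is 0, these spots are at least 1.\<close>

lemma unit_interval_parks_count_upper:
  assumes "unit_interval_parks n S as" "0 \<notin> set as"
  shows "length (filter (\<lambda>x. x \<le> v) as) \<le> card ({1..Suc v} - S)"
  using assms
proof (induction as arbitrary: S)
  case (Cons a as)
  obtain p where p: "p = a \<or> p = a + 1" "p \<notin> S" "unit_interval_parks n (insert p S) as"
    using Cons.prems(1) by (auto split: if_splits)
  have "length (filter (\<lambda>x. x \<le> v) as) \<le> card ({1..Suc v} - insert p S)"
    using Cons.IH[OF p(3)] Cons.prems(2) by simp
  moreover have "(if a \<le> v then 1 else 0) \<le> (if p \<in> {1..Suc v} - S then 1 else 0 :: nat)"
    using p(1,2) Cons.prems(2) by auto
  moreover have "card ({1..Suc v} - S) = card ({1..Suc v} - insert p S) + (if p \<in> {1..Suc v} - S then 1 else 0)"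
    by (rule card_Diff_insert) simp
  moreover have "length (filter (\<lambda>x. x \<le> v) (a # as))
      = length (filter (\<lambda>x. x \<le> v) as) + (if a \<le> v then 1 else 0)"
    by simp
  ultimately show ?case by linarith
qed simp

text \<open>Cars and free spots are equally many, so every free spot up to \<open>v\<close> gets
  filled. As cars only move forward, it is filled by a car with preference at most
  \<open>v\<close>.\<close>

lemma unit_interval_parks_count_lower:
  assumes "unit_interval_parks n S as" "set as \<subseteq> {1..n}" "S \<subseteq> {1..n}"
    "length as + card S = n" "v \<le> n"
  shows "card ({1..v} - S) \<le> length (filter (\<lambda>x. x \<le> v) as)"
  using assms
proof (induction as arbitrary: S)
  case Nil
  then have "S = {1..n}" by (intro card_subset_eq) auto
  then show ?case using Nil by simp
next
  case (Cons a as)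
  obtain p where p: "p = a \<or> p = a + 1" "p \<notin> S" "p \<in> {1..n}"
      "unit_interval_parks n (insert p S) as"
    using Cons.prems(1,2) by (auto split: if_splits)
  have "finite S" using Cons.prems(3) finite_subset by blast
  then have "card ({1..v} - insert p S) \<le> length (filter (\<lambda>x. x \<le> v) as)"
    using Cons.prems p by (intro Cons.IH) auto
  moreover have "(if p \<in> {1..v} - S then 1 else 0) \<le> (if a \<le> v then 1 else 0 :: nat)"
    using p(1) by auto
  moreover have "card ({1..v} - S) = card ({1..v} - insert p S) + (if p \<in> {1..v} - S then 1 else 0)"
    by (rule card_Diff_insert) simp
  moreover have "length (filter (\<lambda>x. x \<le> v) (a # as))
      = length (filter (\<lambda>x. x \<le> v) as) + (if a \<le> v then 1 else 0)"
    by simp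
  ultimately show ?case by linarith
qed

lemma sorted_nth_le_iff_less_count:
  fixes xs :: "'a::linorder list"
  assumes "sorted xs" "i < length xs"
  shows "xs ! i \<le> v \<longleftrightarrow> i < length (filter (\<lambda>x. x \<le> v) xs)"
  using assms
proof (induction xs arbitrary: i)
  case (Cons x xs)
  show ?case
  proof (cases "x \<le> v")
    case True
    then show ?thesis using Cons by (cases i) auto
  next
    case False
    then have "\<forall>y\<in>set (x # xs). \<not> y \<le> v" using Cons.prems(1) by auto
    moreover from this have "filter (\<lambda>x. x \<le> v) (x # xs) = []" by (simp add: filter_empty_conv)
    ultimately show ?thesis using Cons.prems(2) nth_mem[of i "x # xs"] by (metis length_0_conv not_less0)
  qed
qed simp

text \<open>Both counts are applied to the empty street: at least \<open>i + 1\<close> entries are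
  at most \<open>i + 1\<close>, and for positive \<open>i\<close> at most \<open>i\<close> entries
  are at most \<open>i - 1\<close>.\<close>

lemma UPF_sort_nth:
  assumes "\<alpha> \<in> UPF n" "i < n"
  shows "sort \<alpha> ! i = i \<or> sort \<alpha> ! i = i + 1"
proof -
  have \<alpha>: "length \<alpha> = n" "set \<alpha> \<subseteq> {1..n}" "unit_interval_parks n {} \<alpha>"
    using assms(1) by (auto simp: UPF_def)
  have cnt: "length (filter (\<lambda>x. x \<le> v) (sort \<alpha>)) = length (filter (\<lambda>x. x \<le> v) \<alpha>)" for v
    by (simp add: filter_sort)
  have iff: "sort \<alpha> ! i \<le> v \<longleftrightarrow> i < length (filter (\<lambda>x. x \<le> v) \<alpha>)" for v
    using sorted_nth_le_iff_less_count[of "sort \<alpha>" i v] assms(2) \<alpha>(1) cnt by simp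
  have "sort \<alpha> ! i \<le> i + 1"
    using unit_interval_parks_count_lower[OF \<alpha>(3,2), of "i + 1"] \<alpha>(1) assms(2) iff by simp
  moreover have "i \<le> sort \<alpha> ! i"
  proof (cases i)
    case (Suc j)
    have "0 \<notin> set \<alpha>" using \<alpha>(2) by auto
    then have "length (filter (\<lambda>x. x \<le> j) \<alpha>) \<le> i"
      using unit_interval_parks_count_upper[OF \<alpha>(3), of j] Suc by simp
    then show ?thesis using iff[of j] Suc by simp
  qed simp
  ultimately show ?thesis by auto
qed

section \<open>Parking rearrangements\<close>

text \<open>
  The preference matched with spot \<open>p\<close>, when \<open>B\<close> is the set of 0-based block starts: this is the
  entry of the increasing rearrangement at the 0-based position \<open>p - 1\<close>.
\<close>

definition spot_preference :: "nat set \<Rightarrow> nat \<Rightarrow> nat" where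
  "spot_preference B p = (if p - 1 \<in> B then p else p - 1)"

text \<open>The preferences \<open>y < x\<close> lie in different blocks iff some block start \<open>s\<close> has \<open>y \<le> s < x\<close>.\<close>

definition block_ordered :: "nat set \<Rightarrow> nat \<Rightarrow> nat \<Rightarrow> bool" where
  "block_ordered B x y \<longleftrightarrow> x \<le> y \<or> {y..<x} \<inter> B \<noteq> {}"

text \<open>Keeps the matching of waiting cars with free spots when the first car leaves with its
  matched spot \<open>p\<close>.\<close>

lemma mset_remaining_step:
  assumes "mset (a # as) = image_mset f (mset_set (A - S))" "finite A" "p \<in> A - S" "f p = a"
  shows "mset as = image_mset f (mset_set (A - insert p S))"
proof -
  have "A - insert p S = A - S - {p}" by auto
  moreover have "mset_set (A - S) = add_mset p (mset_set (A - S - {p}))"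
    using assms(2,3) by (intro mset_set.remove) auto
  ultimately show ?thesis using assms(1,4) by simp
qed

text \<open>The first hypothesis says that the occupied spots of each block form an initial segment:
  spot \<open>Suc i\<close> opens a block exactly when \<open>i\<close> is in \<open>B\<close>.
  Descending from \<open>a\<close> therefore stays in \<open>S\<close> until a block start
  intervenes.\<close>

lemma downward_closed_in_block:
  assumes "\<And>i. 1 \<le> i \<Longrightarrow> i \<notin> B \<Longrightarrow> Suc i \<in> S \<Longrightarrow> i \<in> S"
    and "a \<in> S" "1 \<le> y" "y \<le> a" "{y..<a} \<inter> B = {}"
  shows "y \<in> S"
  using assms(4,2,3,5)
proof (induction rule: inc_induct)
  case (step i)
  then show ?case using assms(1)[of i] by (auto simp: disjoint_iff)
qed

text \<open>Induction over the cars with two invariants: occupied spots are initial segments of the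
  blocks, and the waiting preferences are those matched with the free spots.\<close>

lemma unit_interval_parks_iff_block_ordered:
  assumes "0 \<in> B"
    and "\<And>i. 1 \<le> i \<Longrightarrow> i \<notin> B \<Longrightarrow> Suc i \<in> S \<Longrightarrow> i \<in> S"
    and "mset as = image_mset (spot_preference B) (mset_set ({1..n} - S))"
  shows "unit_interval_parks n S as \<longleftrightarrow> sorted_wrt (block_ordered B) as"
  using assms(2,3)
proof (induction as arbitrary: S)
  case (Cons a as)
  note closed = Cons.prems(1) and rem = Cons.prems(2)
  have IH: "unit_interval_parks n (insert p S) as \<longleftrightarrow> sorted_wrt (block_ordered B) as"
    if "p \<in> {1..n} - S" "spot_preference B p = a" "p - 1 \<in> B \<or> p - 1 \<in> S" for p
  proof (rule Cons.IH)
    show "mset as = image_mset (spot_preference B) (mset_set ({1..n} - insert p S))"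
      using mset_remaining_step[OF rem] that by simp
  next
    fix i assume "1 \<le> i" "i \<notin> B" "Suc i \<in> insert p S"
    then show "i \<in> insert p S" using closed[of i] that(3) by auto
  qed
  have seta: "set (a # as) = spot_preference B ` ({1..n} - S)"
    using arg_cong[OF rem, of set_mset] by simp
  \<comment> \<open>\<open>p\<close> is a free spot matched with preference \<open>a\<close>; it
    need not be the spot in which the car parks.\<close>
  then obtain p where p: "p \<in> {1..n} - S" "spot_preference B p = a"
    by (metis imageE list.set_intros(1))
  then have p_cases: "p = a \<and> a - 1 \<in> B \<or> p = a + 1 \<and> a \<notin> B"
    by (auto simp: spot_preference_def split: if_splits)
  have pos: "1 \<le> y" if y: "y \<in> set (a # as)" for y
  proof -
    obtain q where "q \<in> {1..n}" "spot_preference B q = y"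
      using y unfolding seta by blast
    then show ?thesis using assms(1) by (cases "q = 1") (auto simp: spot_preference_def split: if_splits)
  qed
  show ?case
  proof (cases "a - 1 \<in> B")
    case True
    \<comment> \<open>Here \<open>a\<close> is the least value of its block, so the start
      \<open>a - 1\<close> separates it from every smaller preference.\<close>
    have ord: "block_ordered B a y" for y
    proof (cases "a \<le> y")
      case False
      then have "a - 1 \<in> {y..<a} \<inter> B" using True by auto
      then show ?thesis unfolding block_ordered_def by blast
    qed (simp add: block_ordered_def)
    show ?thesis
    proof (cases "a \<in> S")
      case False
      have "a \<in> {1..n} - S" "spot_preference B a = a"
        using False p(1) p_cases pos[of a] True by (auto simp: spot_preference_def)
      then show ?thesis using IH[of a] True False ord by simp
    next
      case aS: True
      \<comment> \<open>The matched spot is free while \<open>a\<close> is not, so it is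
        \<open>a + 1\<close>, where the car indeed parks.\<close>
      then have "p = a + 1" using p(1) p_cases by auto
      then show ?thesis using IH[of p] p aS ord by simp
    qed
  next
    case False
    then have pa: "p = a + 1" "a \<notin> B" "a + 1 \<le> n" "a + 1 \<notin> S"
      using p(1) p_cases by auto
    have a2: "2 \<le> a"
    proof -
      have "a \<noteq> 1" "1 \<le> a" using False assms(1) pos[of a] by auto
      then show ?thesis by simp
    qed
    show ?thesis
    proof (cases "a \<in> S")
      case True
      \<comment> \<open>A waiting \<open>y < a\<close> of the same block would be matched with a
        free spot among \<open>y, ..., a\<close>, but all of these are occupied below the occupied
        spot \<open>a\<close>.\<close>
      have "block_ordered B a y" if "y \<in> set as" for y
      proof (rule ccontr)
        assume *: "\<not> block_ordered B a y"
        then have y: "y < a" "{y..<a} \<inter> B = {}" by (auto simp: block_ordered_def)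
        obtain q where q: "q \<in> {1..n} - S" "spot_preference B q = y"
          using \<open>y \<in> set as\<close> seta by (metis imageE list.set_intros(2))
        have "1 \<le> y" using pos \<open>y \<in> set as\<close> by simp
        have "q = y \<or> q = Suc y" using q by (auto simp: spot_preference_def split: if_splits)
        then have q': "1 \<le> q" "q \<le> a" "{q..<a} \<subseteq> {y..<a}"
          using y(1) \<open>1 \<le> y\<close> by auto
        then have "{q..<a} \<inter> B = {}" using y(2) by blast
        then have "q \<in> S" using downward_closed_in_block[of B S a q] closed True q'(1,2) by simp
        then show False using q by simp
      qed
      then show ?thesis using IH[of p] p pa True by simp
    next
      case free: False
      have "a \<in> {1..n} - S" using free pa a2 by simp
      \<comment> \<open>Spot \<open>a\<close> is still free, so its matched preference
        \<open>a - 1\<close> is still waiting: the order is violated.\<close>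
      then have wa: "spot_preference B a = a - 1" "a - 1 \<in> set (a # as)"
        using False seta by (auto simp: spot_preference_def image_iff intro!: bexI[of _ a])
      have "\<not> block_ordered B a (a - 1)"
      proof -
        have "{a - 1..<a} = {a - 1}" using a2 by auto
        then show ?thesis using False a2 by (simp add: block_ordered_def)
      qed
      then have nord: "\<not> sorted_wrt (block_ordered B) (a # as)"
        using wa a2 by auto
      \<comment> \<open>The car parks in \<open>a\<close>, although the matching assigns it
        \<open>p = a + 1\<close>. At least as many waiting cars prefer at most \<open>a - 1\<close>
        as there were free spots up to \<open>a\<close>, and one of these spots has just been
        lost.\<close>
      have "\<not> unit_interval_parks n (insert a S) as"
      proof
        assume "unit_interval_parks n (insert a S) as"
        then have "length (filter (\<lambda>x. x \<le> a - 1) as) \<le> card ({1..Suc (a - 1)} - insert a S)"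
        proof (rule unit_interval_parks_count_upper)
          have "0 \<notin> set (a # as)" using pos[of 0] by linarith
          then show "0 \<notin> set as" by simp
        qed
        also have "Suc (a - 1) = a" using a2 by simp
        also have "card ({1..a} - insert a S) < card ({1..a} - S)"
        proof (rule psubset_card_mono)
          have "a \<in> {1..a} - S" using free a2 by simp
          then show "{1..a} - insert a S \<subset> {1..a} - S" by blast
        qed simp
        also have "\<dots> \<le> card {q \<in> {1..n} - insert p S. spot_preference B q \<le> a - 1}"
        proof (rule card_mono)
          show "{1..a} - S \<subseteq> {q \<in> {1..n} - insert p S. spot_preference B q \<le> a - 1}"
          proof
            fix q assume q: "q \<in> {1..a} - S"
            then have "spot_preference B q \<le> a - 1"
              using wa(1) by (cases "q = a") (auto simp: spot_preference_def)
            then show "q \<in> {q \<in> {1..n} - insert p S. spot_preference B q \<le> a - 1}"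
              using q pa(1,3) by auto
          qed
        qed simp
        also have "\<dots> = length (filter (\<lambda>x. x \<le> a - 1) as)"
        proof -
          have "mset as = image_mset (spot_preference B) (mset_set ({1..n} - insert p S))"
            using mset_remaining_step[OF rem] p by simp
          then have "mset (filter (\<lambda>x. x \<le> a - 1) as) = image_mset (spot_preference B)
              (mset_set {q \<in> {1..n} - insert p S. spot_preference B q \<le> a - 1})"
            by (simp add: filter_mset_image_mset)
          then show ?thesis by (metis size_image_mset size_mset size_mset_set)
        qed
        finally show False by simp
      qed
      then show ?thesis using nord free by simp
    qed
  qed
qed simp

section \<open>Shuffles of blocks\<close>

lemma mset_filter_notin_append:
  assumes "set xs \<inter> set ys = {}" "mset \<sigma> = mset (xs @ ys)"
  shows "mset (filter (\<lambda>x. x \<notin> set xs) \<sigma>) = mset ys"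
proof -
  have "filter (\<lambda>x. x \<notin> set xs) xs = []" "filter (\<lambda>x. x \<notin> set xs) ys = ys"
    using assms(1) by (auto simp: filter_empty_conv filter_id_conv)
  then show ?thesis using assms(2) by (metis filter_append mset_filter append_Nil)
qed

text \<open>The binomial factor counts the positions of the first block. The exact quotient
  \<open>c\<close> avoids truncating division.\<close>

lemma multinomial_Cons:
  "multinomial (sum_list (k # ks)) (k # ks)
     = ((k + sum_list ks) choose k) * multinomial (sum_list ks) ks"
proof -
  let ?P = "(\<Prod>k\<leftarrow>ks. fact k) :: nat"
  obtain c where c: "fact (sum_list ks) = ?P * c"
    using prod_list_fact_dvd_fact_sum_list[of ks] by (auto simp: dvd_def)
  have pos: "?P > 0" by (induction ks) auto
  have "fact (k + sum_list ks) = (fact k * ?P) * (((k + sum_list ks) choose k) * c)"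
    using binomial_fact_lemma[of k "k + sum_list ks"] c by (simp add: mult_ac)
  then show ?thesis using pos by (simp add: multinomial_def c)
qed

text \<open>A list is determined by its subword \<open>\<tau>\<close> outside the first block and by
  how \<open>\<pi>\<close> is shuffled into it. Finiteness is carried along for counting the
  disjoint union.\<close>

lemma card_block_shuffles:
  fixes \<pi>s :: "'a list list"
  assumes "sorted_wrt (\<lambda>\<pi> \<rho>. set \<pi> \<inter> set \<rho> = {}) \<pi>s"
  shows "finite {\<sigma>. mset \<sigma> = mset (concat \<pi>s) \<and> (\<forall>\<pi>\<in>set \<pi>s. filter (\<lambda>x. x \<in> set \<pi>) \<sigma> = \<pi>)} \<and>
    card {\<sigma>. mset \<sigma> = mset (concat \<pi>s) \<and> (\<forall>\<pi>\<in>set \<pi>s. filter (\<lambda>x. x \<in> set \<pi>) \<sigma> = \<pi>)}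
      = multinomial (length (concat \<pi>s)) (map length \<pi>s)"
  using assms
proof (induction \<pi>s)
  case Nil
  then show ?case by (simp add: multinomial_def)
next
  case (Cons \<pi> \<pi>s)
  let ?T = "\<lambda>\<pi>s. {\<sigma>. mset \<sigma> = mset (concat \<pi>s) \<and> (\<forall>\<pi>\<in>set \<pi>s. filter (\<lambda>x. x \<in> set \<pi>) \<sigma> = \<pi>)}"
  have disj: "set \<pi> \<inter> set (concat \<pi>s) = {}" and
    disj': "\<And>\<rho>. \<rho> \<in> set \<pi>s \<Longrightarrow> set \<pi> \<inter> set \<rho> = {}"
    using Cons.prems by auto
  have IH: "finite (?T \<pi>s)" "card (?T \<pi>s) = multinomial (length (concat \<pi>s)) (map length \<pi>s)"
    using Cons by auto
  have disjT: "set \<pi> \<inter> set \<tau> = {}" "length \<tau> = length (concat \<pi>s)" if "\<tau> \<in> ?T \<pi>s" for \<tau>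
  proof -
    have "mset \<tau> = mset (concat \<pi>s)" using that by simp
    then show "set \<pi> \<inter> set \<tau> = {}" "length \<tau> = length (concat \<pi>s)"
      using disj mset_eq_setD mset_eq_length by metis+
  qed
  have eq: "?T (\<pi> # \<pi>s) = (\<Union>\<tau>\<in>?T \<pi>s. shuffles \<pi> \<tau>)"
  proof (intro equalityI subsetI)
    fix \<sigma> assume \<sigma>: "\<sigma> \<in> ?T (\<pi> # \<pi>s)"
    let ?\<tau> = "filter (\<lambda>x. x \<notin> set \<pi>) \<sigma>"
    have "\<sigma> \<in> shuffles \<pi> ?\<tau>"
      using partition_in_shuffles[of \<sigma> "\<lambda>x. x \<in> set \<pi>"] \<sigma> by simp
    moreover have "?\<tau> \<in> ?T \<pi>s"
    proof -
      have "filter (\<lambda>x. x \<in> set \<rho>) ?\<tau> = \<rho>" if "\<rho> \<in> set \<pi>s" for \<rho>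
      proof -
        have "filter (\<lambda>x. x \<in> set \<rho>) ?\<tau> = filter (\<lambda>x. x \<in> set \<rho>) \<sigma>"
          using disj'[OF that] by (auto simp: filter_filter intro: filter_cong)
        then show ?thesis using \<sigma> that by simp
      qed
      moreover have "mset ?\<tau> = mset (concat \<pi>s)"
        using \<sigma> disj by (intro mset_filter_notin_append) auto
      ultimately show ?thesis by blast
    qed
    ultimately show "\<sigma> \<in> (\<Union>\<tau>\<in>?T \<pi>s. shuffles \<pi> \<tau>)" by blast
  next
    fix \<sigma> assume "\<sigma> \<in> (\<Union>\<tau>\<in>?T \<pi>s. shuffles \<pi> \<tau>)"
    then obtain \<tau> where \<tau>: "\<tau> \<in> ?T \<pi>s" "\<sigma> \<in> shuffles \<pi> \<tau>" by blast
    note d = disjT(1)[OF \<tau>(1)]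
    have f: "filter (\<lambda>x. x \<in> set \<pi>) \<sigma> = \<pi>" "filter (\<lambda>x. x \<notin> set \<pi>) \<sigma> = \<tau>"
      using filter_shuffles_disjoint1[OF d \<tau>(2)] by auto
    have "mset \<sigma> = mset \<pi> + mset \<tau>" using \<tau>(2) by (rule mset_shuffles)
    moreover have "filter (\<lambda>x. x \<in> set \<rho>) \<sigma> = \<rho>" if "\<rho> \<in> set \<pi>s" for \<rho>
    proof -
      have "filter (\<lambda>x. x \<in> set \<rho>) \<sigma> = filter (\<lambda>x. x \<in> set \<rho>) (filter (\<lambda>x. x \<notin> set \<pi>) \<sigma>)"
        using disj'[OF that] by (auto simp: filter_filter intro: filter_cong)
      then show ?thesis using f(2) \<tau>(1) that by simp
    qed
    ultimately show "\<sigma> \<in> ?T (\<pi> # \<pi>s)" using \<tau>(1) f(1) by simp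
  qed
  \<comment> \<open>Deleting the entries of \<open>\<pi>\<close> recovers \<open>\<tau>\<close> from
    any of its shuffles.\<close>
  have disjoint: "shuffles \<pi> \<tau> \<inter> shuffles \<pi> \<tau>' = {}"
    if "\<tau> \<in> ?T \<pi>s" "\<tau>' \<in> ?T \<pi>s" "\<tau> \<noteq> \<tau>'" for \<tau> \<tau>'
    using filter_shuffles_disjoint1(2)[OF disjT(1)[OF that(1)]]
      filter_shuffles_disjoint1(2)[OF disjT(1)[OF that(2)]] that(3)
    by (metis disjoint_iff)
  have "card (?T (\<pi> # \<pi>s)) = (\<Sum>\<tau>\<in>?T \<pi>s. card (shuffles \<pi> \<tau>))"
    unfolding eq using IH(1) disjoint by (intro card_UN_disjoint) auto
  also have "\<dots> = (\<Sum>\<tau>\<in>?T \<pi>s. (length \<pi> + length (concat \<pi>s)) choose length \<pi>)"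
    using disjT by (intro sum.cong refl) (simp add: card_disjoint_shuffles)
  also have "\<dots> = multinomial (length (concat (\<pi> # \<pi>s))) (map length (\<pi> # \<pi>s))"
    using IH(2) multinomial_Cons[of "length \<pi>" "map length \<pi>s"] by (simp add: length_concat)
  finally show ?case using eq IH(1) by simp
qed

section \<open>Blocks as intervals\<close>

text \<open>Isolates the \<open>zip\<close> in \<open>block_structure\<close>, so that intervals can
  be handled by induction on the starts. A pair \<open>(s, t)\<close> stands for the interval
  \<open>s < v \<le> t\<close>, the spots of one block.\<close>

definition block_bounds :: "nat list \<Rightarrow> nat \<Rightarrow> (nat \<times> nat) list" where
  "block_bounds xs n = zip xs (tl xs @ [n])"

lemma block_bounds_simps:
  "block_bounds [] n = []"
  "block_bounds [x] n = [(x, n)]"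
  "block_bounds (x # y # zs) n = (x, y) # block_bounds (y # zs) n"
  by (simp_all add: block_bounds_def)

lemma block_bounds_in:
  assumes "sorted_wrt (<) xs" "\<forall>x\<in>set xs. x < n" "(s, t) \<in> set (block_bounds xs n)"
  shows "s < t \<and> t \<le> n \<and> s \<in> set xs \<and> (t \<in> set xs \<or> t = n) \<and> {s<..<t} \<inter> set xs = {}"
  using assms
proof (induction xs rule: induct_list012)
  case (3 x y zs)
  show ?case
  proof (cases "(s, t) = (x, y)")
    case True
    then show ?thesis using 3(3,4) by auto
  next
    case False
    then have st: "(s, t) \<in> set (block_bounds (y # zs) n)"
      using 3(5) by (auto simp: block_bounds_simps)
    have *: "s < t \<and> t \<le> n \<and> s \<in> set (y # zs) \<and> (t \<in> set (y # zs) \<or> t = n)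
        \<and> {s<..<t} \<inter> set (y # zs) = {}"
    proof (rule 3(2)[OF _ _ st])
      show "sorted_wrt (<) (y # zs)" "\<forall>x\<in>set (y # zs). x < n" using 3(3,4) by simp_all
    qed
    then have "x < s" using 3(3) by auto
    then have "x \<notin> {s<..<t}" by simp
    then show ?thesis using * by simp
  qed
qed (auto simp: block_bounds_simps)

lemma block_bounds_cover:
  assumes "xs \<noteq> []" "hd xs < v" "v \<le> n"
  shows "\<exists>(s, t)\<in>set (block_bounds xs n). s < v \<and> v \<le> t"
  using assms
proof (induction xs rule: induct_list012)
  case (3 x y zs)
  then show ?case by (cases "v \<le> y") (auto simp: block_bounds_simps)
qed (auto simp: block_bounds_simps)

lemma block_bounds_ordered:
  assumes "sorted_wrt (<) xs" "\<forall>x\<in>set xs. x < n"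
  shows "sorted_wrt (\<lambda>(s, t) (s', t'). t \<le> s') (block_bounds xs n)"
  using assms
proof (induction xs rule: induct_list012)
  case (3 x y zs)
  have "y \<le> s" if "(s, t) \<in> set (block_bounds (y # zs) n)" for s t
    using block_bounds_in[OF _ _ that] 3 by auto
  then show ?case using 3 by (auto simp: block_bounds_simps)
qed (auto simp: block_bounds_simps)

text \<open>Consecutive slices telescope, leaving only the part before the first start
  uncovered.\<close>

lemma concat_block_bounds:
  assumes "xs \<noteq> []" "sorted_wrt (<) xs" "\<forall>x\<in>set xs. x < length l"
  shows "concat (map (\<lambda>(s, t). take (t - s) (drop s l)) (block_bounds xs (length l))) = drop (hd xs) l"
  using assms
proof (induction xs rule: induct_list012)
  case (3 x y zs)
  have "take (y - x) (drop x l) @ drop y l = drop x l"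
    using 3(4) append_take_drop_id[of "y - x" "drop x l"] by simp
  then show ?case using 3 by (simp add: block_bounds_simps)
qed (auto simp: block_bounds_simps)

text \<open>For \<open>y < a\<close>, a start in \<open>{y..<a}\<close> exists exactly when the two
  values lie in different intervals. This turns the pairwise condition into sortedness on each
  interval.\<close>

lemma sorted_wrt_block_ordered_iff:
  assumes "sorted_wrt (<) xs" "\<forall>x\<in>set xs. x < n" "xs \<noteq> []" "hd xs = 0" "set \<sigma> \<subseteq> {1..n}"
  shows "sorted_wrt (block_ordered (set xs)) \<sigma> \<longleftrightarrow>
    (\<forall>(s, t)\<in>set (block_bounds xs n). sorted (filter (\<lambda>x. s < x \<and> x \<le> t) \<sigma>))"
  using assms(5)
proof (induction \<sigma>)
  case (Cons a \<sigma>)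
  have "block_ordered (set xs) a y \<longleftrightarrow>
      (\<forall>(s, t)\<in>set (block_bounds xs n). s < a \<and> a \<le> t \<and> s < y \<and> y \<le> t \<longrightarrow> a \<le> y)"
    (is "_ \<longleftrightarrow> ?R") if "y \<in> set \<sigma>" for y
  proof
    assume *: "block_ordered (set xs) a y"
    have False if st: "(s, t) \<in> set (block_bounds xs n)" "s < a" "a \<le> t" "s < y" "y \<le> t" "y < a" for s t
    proof -
      obtain r where "r \<in> set xs" "y \<le> r" "r < a" using * st by (auto simp: block_ordered_def)
      then show False using block_bounds_in[OF assms(1,2) st(1)] st by (auto simp: disjoint_iff)
    qed
    then show ?R by (auto simp: not_less[symmetric])
  next
    assume R: ?R
    have "0 < a" "a \<le> n" "1 \<le> y" using Cons.prems that by auto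
    \<comment> \<open>This is the interval containing \<open>a\<close>. If \<open>y\<close> lies at
      or below \<open>s\<close>, then \<open>s\<close> itself is a separating start.\<close>
    then obtain s t where st: "(s, t) \<in> set (block_bounds xs n)" "s < a" "a \<le> t"
      using block_bounds_cover[OF assms(3), of a n] assms(4) by auto
    have "s \<in> set xs" using block_bounds_in[OF assms(1,2) st(1)] by simp
    show "block_ordered (set xs) a y"
    proof (cases "s < y")
      case True
      then show ?thesis using R st by (fastforce simp: block_ordered_def)
    next
      case False
      then have "s \<in> {y..<a} \<inter> set xs" using st(2) \<open>s \<in> set xs\<close> by simp
      then show ?thesis unfolding block_ordered_def by blast
    qed
  qed
  then have "(\<forall>y\<in>set \<sigma>. block_ordered (set xs) a y) \<longleftrightarrow> (\<forall>(s, t)\<in>set (block_bounds xs n).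
      s < a \<and> a \<le> t \<longrightarrow> (\<forall>y\<in>set (filter (\<lambda>x. s < x \<and> x \<le> t) \<sigma>). a \<le> y))"
    by (simp add: split_beta) blast
  moreover have "sorted (filter (\<lambda>x. s < x \<and> x \<le> t) (a # \<sigma>)) \<longleftrightarrow>
      (s < a \<and> a \<le> t \<longrightarrow> (\<forall>y\<in>set (filter (\<lambda>x. s < x \<and> x \<le> t) \<sigma>). a \<le> y)) \<and>
      sorted (filter (\<lambda>x. s < x \<and> x \<le> t) \<sigma>)" for s t
    by (cases "s < a \<and> a \<le> t") auto
  moreover have "sorted_wrt (block_ordered (set xs)) \<sigma> \<longleftrightarrow>
      (\<forall>(s, t)\<in>set (block_bounds xs n). sorted (filter (\<lambda>x. s < x \<and> x \<le> t) \<sigma>))"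
    using Cons by simp
  ultimately show ?case unfolding sorted_wrt.simps(2) split_beta by blast
qed simp

section \<open>The block structure of a unit interval parking function\<close>

lemma block_starts_facts:
  "sorted_wrt (<) (block_starts \<alpha>)"
  "set (block_starts \<alpha>) = {i. i < length \<alpha> \<and> sort \<alpha> ! i = i + 1}"
  by (auto simp: block_starts_def sorted_wrt_filter)

lemma block_structure_eq:
  "block_structure \<alpha> = map (\<lambda>(s, t). take (t - s) (drop s (sort \<alpha>)))
     (block_bounds (block_starts \<alpha>) (length \<alpha>))"
  by (simp add: block_structure_def block_bounds_def)

lemma UPF_block_starts_0:
  assumes "\<alpha> \<in> UPF n" "0 < n"
  shows "block_starts \<alpha> \<noteq> []" "hd (block_starts \<alpha>) = 0"
proof -
  have \<alpha>: "length \<alpha> = n" "set \<alpha> \<subseteq> {1..n}" using assms(1) by (auto simp: UPF_def)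
  have "sort \<alpha> ! 0 \<in> set \<alpha>" using \<alpha> assms(2) by (metis length_sort nth_mem set_sort)
  then have "sort \<alpha> ! 0 = 1" using UPF_sort_nth[OF assms] \<alpha>(2) by auto
  moreover have "[0..<n] = 0 # [1..<n]" using assms(2) by (simp add: upt_conv_Cons)
  ultimately show "block_starts \<alpha> \<noteq> []" "hd (block_starts \<alpha>) = 0"
    by (simp_all add: block_starts_def \<alpha>(1))
qed

text \<open>A block is cut out by positions, but the order criterion speaks of values. By
  \<open>UPF_sort_nth\<close>, positions before \<open>s\<close> hold values at most
  \<open>s\<close>, those from \<open>t\<close> on hold values above \<open>t\<close>, and those
  between hold values in the interval.\<close>

lemma UPF_block_eq_filter:
  assumes "\<alpha> \<in> UPF n" "(s, t) \<in> set (block_bounds (block_starts \<alpha>) n)"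
  shows "take (t - s) (drop s (sort \<alpha>)) = filter (\<lambda>x. s < x \<and> x \<le> t) (sort \<alpha>)"
proof -
  let ?l = "sort \<alpha>" and ?P = "\<lambda>x. s < x \<and> x \<le> t"
  have len: "length \<alpha> = n" using assms(1) by (simp add: UPF_def)
  have st: "s < t" "t \<le> n" "?l ! s = s + 1" "t < n \<Longrightarrow> ?l ! t = t + 1"
    and inner: "\<And>i. s < i \<Longrightarrow> i < t \<Longrightarrow> ?l ! i \<noteq> i + 1"
    using block_bounds_in[OF block_starts_facts(1) _ assms(2)] block_starts_facts(2)[of \<alpha>] len
    by (auto simp: disjoint_iff)
  note nth = UPF_sort_nth[OF assms(1)]
  have "\<not> ?P x" if x: "x \<in> set (take s ?l)" for x
  proof -
    obtain i where "x = ?l ! i" "i < s" using x len by (auto simp: in_set_conv_nth)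
    then show ?thesis using nth[of i] st(1,2) by auto
  qed
  then have 1: "filter ?P (take s ?l) = []" by (simp add: filter_empty_conv)
  \<comment> \<open>At position \<open>t\<close> the value \<open>t\<close> is excluded because
    \<open>t\<close> is again a block start; later positions hold at least their own index.\<close>
  have "\<not> ?P x" if x: "x \<in> set (drop t ?l)" for x
  proof -
    obtain i where i: "x = ?l ! (t + i)" "t + i < n"
      using x len st(2) by (auto simp: in_set_conv_nth)
    then show ?thesis using nth[of "t + i"] st(4) by (cases i) auto
  qed
  then have 3: "filter ?P (drop t ?l) = []" by (simp add: filter_empty_conv)
  have "?P x" if x: "x \<in> set (take (t - s) (drop s ?l))" for x
  proof -
    obtain i where i: "x = ?l ! (s + i)" "s + i < t"
      using x len st(1,2) by (auto simp: in_set_conv_nth)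
    then show ?thesis using nth[of "s + i"] st inner[of "s + i"] by (cases i) auto
  qed
  then have 2: "filter ?P (take (t - s) (drop s ?l)) = take (t - s) (drop s ?l)"
    by (simp add: filter_id_conv)
  have "?l = take s ?l @ take (t - s) (drop s ?l) @ drop t ?l"
    using st(1) append_take_drop_id[of "t - s" "drop s ?l"] by simp
  then have "filter ?P ?l = filter ?P (take s ?l @ take (t - s) (drop s ?l) @ drop t ?l)" by simp
  then show ?thesis using 1 2 3 by simp
qed

text \<open>Provides the initial matching with all \<open>n\<close> spots free. Position
  \<open>i\<close> corresponds to spot \<open>i + 1\<close>, hence the shift by
  \<open>Suc\<close>.\<close>

lemma UPF_mset:
  assumes "\<alpha> \<in> UPF n"
  shows "mset \<alpha> = image_mset (spot_preference (set (block_starts \<alpha>))) (mset_set {1..n})"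
proof -
  have len: "length \<alpha> = n" using assms by (simp add: UPF_def)
  have "sort \<alpha> = map (spot_preference (set (block_starts \<alpha>)) \<circ> Suc) [0..<n]"
    using UPF_sort_nth[OF assms] len
    by (intro nth_equalityI) (auto simp: spot_preference_def block_starts_facts)
  also have "\<dots> = map (spot_preference (set (block_starts \<alpha>))) [1..<Suc n]"
    by (metis One_nat_def map_Suc_upt map_map)
  finally have "mset (sort \<alpha>) = mset (map (spot_preference (set (block_starts \<alpha>))) [1..<Suc n])"
    by (rule arg_cong)
  moreover have "mset [1..<Suc n] = mset_set {1..n}"
    by (metis atLeastLessThanSuc_atLeastAtMost mset_upt)
  ultimately show ?thesis by (metis mset_map mset_sort)
qed

text \<open>The parking criterion sees only the multiset and the order of the entries, so the block
  starts of \<open>\<alpha>\<close> serve for every rearrangement. The empty list is separate,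
  having no start at 0.\<close>

lemma UPF_rearrangement_iff:
  assumes "\<alpha> \<in> UPF n" "mset \<sigma> = mset \<alpha>"
  shows "\<sigma> \<in> UPF n \<longleftrightarrow> (\<forall>\<pi>\<in>set (block_structure \<alpha>). filter (\<lambda>x. x \<in> set \<pi>) \<sigma> = \<pi>)"
proof (cases "n = 0")
  case True
  then have "\<alpha> = []" using assms(1) by (simp add: UPF_def)
  then have "\<sigma> = \<alpha>" "block_structure \<alpha> = []"
    using assms(2) by (simp_all add: block_structure_def block_starts_def)
  then show ?thesis using assms(1) by simp
next
  case False
  let ?xs = "block_starts \<alpha>"
  have len: "length \<alpha> = n" "set \<alpha> \<subseteq> {1..n}" using assms(1) by (auto simp: UPF_def)
  have \<sigma>: "length \<sigma> = n" "set \<sigma> \<subseteq> {1..n}" "set \<sigma> = set \<alpha>"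
    using len mset_eq_length[OF assms(2)] mset_eq_setD[OF assms(2)] by simp_all
  note xs = UPF_block_starts_0[OF assms(1)] block_starts_facts[of \<alpha>]
  have "0 \<in> set ?xs" using xs(1,2) False by (metis hd_in_set neq0_conv)
  then have "\<sigma> \<in> UPF n \<longleftrightarrow> sorted_wrt (block_ordered (set ?xs)) \<sigma>"
    using unit_interval_parks_iff_block_ordered[of "set ?xs" "{}" \<sigma> n] UPF_mset[OF assms(1)] \<sigma> assms(2)
    by (simp add: UPF_def)
  also have "\<dots> \<longleftrightarrow> (\<forall>(s, t)\<in>set (block_bounds ?xs n). sorted (filter (\<lambda>x. s < x \<and> x \<le> t) \<sigma>))"
    using xs len \<sigma> False by (intro sorted_wrt_block_ordered_iff) auto
  also have "\<dots> \<longleftrightarrow> (\<forall>(s, t)\<in>set (block_bounds ?xs n).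
      filter (\<lambda>x. x \<in> set (take (t - s) (drop s (sort \<alpha>)))) \<sigma> = take (t - s) (drop s (sort \<alpha>)))"
  proof (intro ball_cong refl, clarify)
    fix s t assume st: "(s, t) \<in> set (block_bounds ?xs n)"
    let ?P = "\<lambda>x. s < x \<and> x \<le> t" and ?\<pi> = "take (t - s) (drop s (sort \<alpha>))"
    have \<pi>: "?\<pi> = filter ?P (sort \<alpha>)" by (rule UPF_block_eq_filter[OF assms(1) st])
    have f: "filter (\<lambda>x. x \<in> set ?\<pi>) \<sigma> = filter ?P \<sigma>"
      unfolding \<pi> using \<sigma>(3) by (intro filter_cong) auto
    \<comment> \<open>A sorted list is determined by its multiset, so being sorted on the interval
      means being equal to the block.\<close>
    have "mset (filter ?P \<sigma>) = mset ?\<pi>" unfolding \<pi> using assms(2) by simp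
    moreover have "sorted ?\<pi>" unfolding \<pi> by (simp add: sorted_wrt_filter)
    ultimately have "sorted (filter ?P \<sigma>) \<longleftrightarrow> filter ?P \<sigma> = ?\<pi>"
      by (metis properties_for_sort)
    then show "sorted (filter ?P \<sigma>) = (filter (\<lambda>x. x \<in> set ?\<pi>) \<sigma> = ?\<pi>)" using f by simp
  qed
  finally show ?thesis by (auto simp: block_structure_eq len(1) split_beta)
qed

lemma UPF_concat_block_structure:
  assumes "\<alpha> \<in> UPF n"
  shows "concat (block_structure \<alpha>) = sort \<alpha>"
proof (cases "n = 0")
  case True
  then have "\<alpha> = []" using assms by (simp add: UPF_def)
  then show ?thesis by (simp add: block_structure_def block_starts_def)
next
  case False
  then show ?thesis
    using concat_block_bounds[of "block_starts \<alpha>" "sort \<alpha>"] UPF_block_starts_0[OF assms]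
      block_starts_facts[of \<alpha>]
    by (simp add: block_structure_eq)
qed

text \<open>By \<open>UPF_block_eq_filter\<close> the blocks take their values from successive
  disjoint intervals.\<close>

lemma UPF_blocks_disjoint:
  assumes "\<alpha> \<in> UPF n"
  shows "sorted_wrt (\<lambda>\<pi> \<rho>. set \<pi> \<inter> set \<rho> = {}) (block_structure \<alpha>)"
proof -
  have len: "length \<alpha> = n" using assms by (simp add: UPF_def)
  have "sorted_wrt (\<lambda>(s, t) (s', t'). t \<le> s') (block_bounds (block_starts \<alpha>) n)"
    using block_starts_facts[of \<alpha>] len by (intro block_bounds_ordered) auto
  then show ?thesis
    unfolding block_structure_eq sorted_wrt_map len
    by (rule sorted_wrt_mono_rel[rotated]) (auto simp: UPF_block_eq_filter[OF assms] split_beta)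
qed

theorem theorem2p9:
  fixes n :: nat and \<alpha> :: "nat list"
  assumes "\<alpha> \<in> UPF n"
  shows "card {\<sigma>. mset \<sigma> = mset \<alpha> \<and> \<sigma> \<in> UPF n}
           = multinomial n (map length (block_structure \<alpha>))
       \<and> (\<forall>\<sigma>. mset \<sigma> = mset \<alpha> \<longrightarrow>
            (\<sigma> \<in> UPF n \<longleftrightarrow>
             (\<forall>\<pi>\<in>set (block_structure \<alpha>). filter (\<lambda>x. x \<in> set \<pi>) \<sigma> = \<pi>)))"
proof -
  \<comment> \<open>The order criterion identifies the parking rearrangements with the block
    shuffles, so the count follows from the characterization.\<close>
  have "{\<sigma>. mset \<sigma> = mset \<alpha> \<and> \<sigma> \<in> UPF n} = {\<sigma>. mset \<sigma> = mset (concat (block_structure \<alpha>)) \<and>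
      (\<forall>\<pi>\<in>set (block_structure \<alpha>). filter (\<lambda>x. x \<in> set \<pi>) \<sigma> = \<pi>)}"
    using UPF_rearrangement_iff[OF assms] UPF_concat_block_structure[OF assms] by auto
  moreover have "length (concat (block_structure \<alpha>)) = n"
    using assms UPF_concat_block_structure[OF assms] by (simp add: UPF_def)
  ultimately show ?thesis
    using card_block_shuffles[OF UPF_blocks_disjoint[OF assms]] UPF_rearrangement_iff[OF assms]
    by simp
qed

end
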